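(* There exists a constant $C>0$ such that for all $n$ the integrity of the hypercube satisfies $$I(Q_n)\le C\frac{2^n}{\sqrt{n}}\sqrt{\log n}.$$
   Context: $Q_n$ is the $n$-dimensional hypercube: vertex set $\{0,1\}^n$, two vertices adjacent iff they differ in exactly one coordinate. For a graph $H$, $m(H)$ denotes the number of vertices in a largest connected component of $H$. The integrity of a graph $G$ is $I(G)=\min\{|S|+m(G\setminus S): S\subseteq V(G)\}$.
   Formalization: The bound is proved for all n ≥ 2 instead of all n: at n = 0 the right-hand side is undefined, and at n = 1 it equals 0 (log 1 = 0) while I(Q_1) = 2. *)

theory Defs
  imports Complex_Main "HOL-Library.FuncSet" "Graph_Theory.Graph_Theory"
begin

text \<open>Undirected graphs are symmetric digraphs, as in the library: an edge is a pair of
  opposite arcs.\<close>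

definition hypercube :: "nat \<Rightarrow> (nat \<Rightarrow> nat) pair_pre_digraph" where
  "hypercube n =
    \<lparr> pverts = {..<n} \<rightarrow>\<^sub>E {0, 1},
      parcs = {(x, y). x \<in> {..<n} \<rightarrow>\<^sub>E {0, 1} \<and> y \<in> {..<n} \<rightarrow>\<^sub>E {0, 1} \<and>
                       (\<exists>!i. i < n \<and> x i \<noteq> y i)} \<rparr>"

text \<open>\<open>connected\<close> is qualified to tell it from the topological constant; the null graph
  is not connected in this sense, so components are nonempty.\<close>

definition components :: "('a, 'b) pre_digraph \<Rightarrow> ('a, 'b) pre_digraph set" where
  "components G = {H. pre_digraph.max_subgraph G Digraph_Component.connected H}"

text \<open>The \<open>0\<close> only matters for the null graph, which has no components.  It arises in
  \<open>integrity\<close> when all vertices are deleted.\<close>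

definition max_component_order :: "('a, 'b) pre_digraph \<Rightarrow> nat" where
  "max_component_order G = Max (insert 0 ((\<lambda>H. card (verts H)) ` components G))"

text \<open>Meant for finite graphs: then the minimum is over a finite nonempty set.\<close>

definition integrity :: "('a, 'b) pre_digraph \<Rightarrow> nat" where
  "integrity G = Min ((\<lambda>S. card S + max_component_order (G \<restriction> (verts G - S))) ` Pow (verts G))"

lemma pair_graph_hypercube: "pair_graph (hypercube n)"
proof
  have sub: "parcs (hypercube n) \<subseteq> pverts (hypercube n) \<times> pverts (hypercube n)"
    unfolding hypercube_def by auto
  show fin: "finite (pverts (hypercube n))"
    unfolding hypercube_def by (simp add: finite_PiE)
  show "finite (parcs (hypercube n))"
    using sub by (rule finite_subset) (simp add: fin)
  show "symmetric (with_proj (hypercube n))"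
  proof -
    have "(\<exists>!i. i < n \<and> x i \<noteq> y i) \<Longrightarrow> (\<exists>!i. i < n \<and> y i \<noteq> x i)" for x y :: "nat \<Rightarrow> nat"
      by (simp only: eq_commute[of "x _"])
    then show ?thesis
      unfolding symmetric_def sym_def by (simp add: hypercube_def)
  qed
  fix e assume e: "e \<in> parcs (hypercube n)"
  show "fst e \<in> pverts (hypercube n)" "snd e \<in> pverts (hypercube n)"
    using sub e by auto
  show "fst e \<noteq> snd e"
    using e by (cases e) (simp add: hypercube_def, blast)
qed

text \<open>On symmetric digraphs the components are the library's strongly connected components.\<close>

lemma components_eq_sccs:
  assumes "sym_digraph G"
  shows "components G = pre_digraph.sccs G"
proof -
  interpret sym_digraph G by fact
  have ind: "Digraph_Component.connected (G \<restriction> verts H) \<and> strongly_connected (G \<restriction> verts H)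
      \<and> subgraph H (G \<restriction> verts H) \<and> induced_subgraph (G \<restriction> verts H) G"
    if H: "subgraph H G" "Digraph_Component.connected H" for H
  proof -
    have sub: "verts H \<subseteq> verts G" using H by auto
    then have i: "induced_subgraph (G \<restriction> verts H) G" by (rule induced_induce)
    interpret I: wf_digraph "G \<restriction> verts H" using i by auto
    have HI: "subgraph H (G \<restriction> verts H)"
      using H(1) I.wf_digraph_axioms
      by (auto simp: subgraph_def compatible_def wf_digraph_def)
    then have sp: "spanning H (G \<restriction> verts H)" by (simp add: spanning_def)
    have c: "Digraph_Component.connected (G \<restriction> verts H)"
      by (rule I.connected_spanning_imp_connected[OF sp H(2)])
    have "symmetric (G \<restriction> verts H)"
      using sym_arcs by (fastforce simp: symmetric_conv)
    with c have "strongly_connected (G \<restriction> verts H)"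
      by (intro I.symmetric_connected_imp_strongly_connected)
    with c HI i show ?thesis by blast
  qed
  have sc: "Digraph_Component.connected H" if "subgraph H G" "strongly_connected H" for H
  proof -
    interpret K: wf_digraph H using that by auto
    show ?thesis using that(2) K.reachable_mk_symmetricI
      by (auto simp: Digraph_Component.connected_def strongly_connected_def)
  qed
  have "max_subgraph Digraph_Component.connected H \<longleftrightarrow> max_subgraph strongly_connected H" for H
  proof
    assume m: "max_subgraph Digraph_Component.connected H"
    then have H: "subgraph H G" "Digraph_Component.connected H" by (auto simp: max_subgraph_def)
    have "subgraph (G \<restriction> verts H) G" using ind[OF H] induced_imp_subgraph by blast
    then have "G \<restriction> verts H = H"
      using ind[OF H] m unfolding max_subgraph_def by blast
    then have "strongly_connected H" using ind[OF H] by simp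
    then show "max_subgraph strongly_connected H"
      using m sc unfolding max_subgraph_def by blast
  next
    assume m: "max_subgraph strongly_connected H"
    then have H: "subgraph H G" "strongly_connected H" by (auto simp: max_subgraph_def)
    show "max_subgraph Digraph_Component.connected H"
      unfolding max_subgraph_def
    proof (intro conjI allI impI notI)
      show "subgraph H G" by fact
      show "Digraph_Component.connected H" using sc H by blast
      fix K assume K: "K \<noteq> H \<and> subgraph H K" "subgraph K G \<and> Digraph_Component.connected K"
      let ?I = "G \<restriction> verts K"
      have I: "subgraph ?I G" "strongly_connected ?I" "subgraph K ?I"
        using ind K induced_imp_subgraph by blast+
      have "subgraph H ?I" using K I subgraph_trans by blast
      then have "?I = H" using m I unfolding max_subgraph_def by blast
      with I K have "verts H = verts K" "arcs H = arcs K" "tail H = tail K" "head H = head K"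
        by (auto simp: subgraph_def compatible_def)
      then show False using K by (simp add: pre_digraph.equality)
    qed
  qed
  then show ?thesis by (simp add: components_def sccs_altdef2)
qed

end

theory Submission
  imports "HOL-Probability.Hoeffding" Defs
begin

text \<open>Carve Hamming balls of radius \<open>r\<close> out of the cube one after another, always deleting the part
  of the bounding sphere that is still there. Every component that remains lies in one ball, so its
  order is at most the ball size \<open>b\<close>. Averaging over the centre lets every step delete at most a
  fraction \<open>s / b\<close> of what it carves out, where \<open>s\<close> is the sphere size, so that at most
  \<open>2 ^ n * s / b\<close> vertices are deleted in total.
  With \<open>e = sqrt (ln n / n)\<close> and \<open>r\<close> about \<open>n / 2 - n * e / 2\<close>, Hoeffding's inequality bounds
  \<open>b / 2 ^ n\<close> by \<open>1 / sqrt n\<close>. Below \<open>r\<close>, consecutive binomial coefficients have ratio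
  \<open>1 - O(e)\<close>, so the last \<open>1 / (20 * e)\<close> spheres of the ball have comparable size and \<open>s / b = O(e)\<close>.\<close>

section \<open>Bounding integrity by a vertex labelling that is constant along arcs\<close>

text \<open>Connectedness is reachability in the symmetric closure, and equality of labels at the
  two ends survives reversing an arc, so it propagates along every path there.\<close>

lemma connected_const_on_arcs:
  assumes "Digraph_Component.connected H"
    and "\<And>e. e \<in> arcs H \<Longrightarrow> c (tail H e) = c (head H e)"
    and "u \<in> verts H" "v \<in> verts H"
  shows "c u = c v"
proof -
  have "u \<rightarrow>\<^sup>*\<^bsub>with_proj (mk_symmetric H)\<^esub> v"
    using assms(1,3,4) by (simp add: Digraph_Component.connected_def strongly_connected_def)
  then have "(u, v) \<in> (arcs_ends (with_proj (mk_symmetric H)))\<^sup>*"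
    by (rule reachable_rtranclI)
  then show ?thesis
    by (induction rule: rtrancl_induct)
      (use assms(2) in \<open>auto simp: arcs_ends_def arc_to_ends_def parcs_mk_symmetric\<close>)
qed

text \<open>Each component lies inside a single fibre of \<open>c\<close>, so no path in
  \<open>G\<close> has to be analysed: a labelling certifies the bound.\<close>

lemma max_component_order_le:
  assumes fin: "finite (verts G)"
    and arc: "\<And>e. e \<in> arcs G \<Longrightarrow> c (tail G e) = c (head G e)"
    and m: "\<And>x. x \<in> verts G \<Longrightarrow> card {y \<in> verts G. c y = c x} \<le> m"
  shows "max_component_order G \<le> m"
proof -
  \<comment> \<open>The second conjunct makes the set of orders finite, which \<open>Max\<close>
    requires; the set of components itself need not be shown finite.\<close>
  have bound: "card (verts H) \<le> m \<and> card (verts H) \<le> card (verts G)" if "H \<in> components G" for H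
  proof -
    from that have sub: "subgraph H G" and con: "Digraph_Component.connected H"
      by (auto simp: components_def pre_digraph.max_subgraph_def)
    then have vs: "verts H \<subseteq> verts G" by auto
    from con obtain x where x: "x \<in> verts H"
      by (auto simp: Digraph_Component.connected_def strongly_connected_def)
    have "c (tail H e) = c (head H e)" if "e \<in> arcs H" for e
      using sub that arc[of e] by (auto simp: subgraph_def compatible_def)
    then have "verts H \<subseteq> {y \<in> verts G. c y = c x}"
      using connected_const_on_arcs[OF con, of c] x vs by blast
    then have "card (verts H) \<le> card {y \<in> verts G. c y = c x}"
      using fin by (intro card_mono) auto
    moreover have "card (verts H) \<le> card (verts G)"
      using vs fin by (intro card_mono)
    ultimately show ?thesis using m x vs by fastforce
  qed
  then have "(\<lambda>H. card (verts H)) ` components G \<subseteq> {..card (verts G)}" by blast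
  then have "finite ((\<lambda>H. card (verts H)) ` components G)"
    by (rule finite_subset) simp
  then show ?thesis
    unfolding max_component_order_def using bound by (subst Max_le_iff) blast+
qed

lemma integrity_le:
  assumes fin: "finite (verts G)" and S: "S \<subseteq> verts G"
    and arc: "\<And>e. e \<in> arcs G \<Longrightarrow> tail G e \<in> verts G - S \<Longrightarrow> head G e \<in> verts G - S
      \<Longrightarrow> c (tail G e) = c (head G e)"
    and m: "\<And>x. x \<in> verts G - S \<Longrightarrow> card {y \<in> verts G - S. c y = c x} \<le> m"
  shows "integrity G \<le> card S + m"
proof -
  have "max_component_order (G \<restriction> (verts G - S)) \<le> m"
    by (rule max_component_order_le[where c = c])
      (use fin arc m in \<open>auto simp: induce_subgraph_def\<close>)
  moreover have "integrity G \<le> card S + max_component_order (G \<restriction> (verts G - S))"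
    unfolding integrity_def using fin S by (intro Min_le) auto
  ultimately show ?thesis by linarith
qed

section \<open>Greedy carving of balls, with an averaging argument for the centre\<close>

lemma sum_card_swap:
  assumes "finite A" "finite B"
  shows "(\<Sum>v\<in>B. card {x \<in> A. P x v}) = (\<Sum>x\<in>A. card {v \<in> B. P x v})"
proof -
  have "(\<Sum>v\<in>B. card {x \<in> A. P x v}) = (\<Sum>v\<in>B. \<Sum>x\<in>A. if P x v then 1 else 0)"
    using assms by (simp add: sum.If_cases Int_def)
  also have "\<dots> = (\<Sum>x\<in>A. \<Sum>v\<in>B. if P x v then 1 else 0)"
    by (rule sum.swap)
  finally show ?thesis
    using assms by (simp add: sum.If_cases Int_def)
qed

text \<open>The set \<open>R\<close> is what remains to be carved, and the induction removes one
  ball's share of it. The labelling \<open>c\<close> records the centre of the ball that took each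
  surviving point, so its fibres are confined to balls and adjacent survivors share a label.\<close>

lemma ball_decomposition:
  fixes d :: "'a \<Rightarrow> 'a \<Rightarrow> nat"
  assumes fin: "finite V"
    and refl: "\<And>x. x \<in> V \<Longrightarrow> d x x = 0"
    and lip: "\<And>x y v. x \<in> V \<Longrightarrow> y \<in> V \<Longrightarrow> v \<in> V \<Longrightarrow> adj x y \<Longrightarrow>
      d x v \<le> d y v + 1 \<and> d y v \<le> d x v + 1"
    and sphere: "\<And>x. x \<in> V \<Longrightarrow> card {v \<in> V. d x v = r} = s"
    and ball: "\<And>x. x \<in> V \<Longrightarrow> card {v \<in> V. d x v \<le> r} = b"
    and R: "R \<subseteq> V"
  shows "\<exists>S c. S \<subseteq> R \<and> card S * b \<le> card R * s \<and>
    (\<forall>x\<in>R - S. c x \<in> V \<and> d x (c x) \<le> r) \<and>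
    (\<forall>x\<in>R - S. \<forall>y\<in>R - S. adj x y \<longrightarrow> c x = c y)"
  using R
proof (induction "card R" arbitrary: R rule: less_induct)
  case less
  have finR: "finite R" using less.prems fin finite_subset by blast
  show ?case
  proof (cases "R = {}")
    case True
    then show ?thesis by (intro exI[of _ "{}"]) auto
  next
    case False
    let ?B = "\<lambda>v. {x \<in> R. d x v \<le> r}" and ?S = "\<lambda>v. {x \<in> R. d x v = r}"
    \<comment> \<open>Averaging over centres: summed over \<open>V\<close>, the balls meet
      \<open>R\<close> in \<open>card R * b\<close> points and the spheres in
      \<open>card R * s\<close>, so some centre has at most the average ratio. A nonempty share is
      demanded so that the remainder shrinks.\<close>
    obtain v where v: "v \<in> V" "?B v \<noteq> {}" "card (?S v) * b \<le> card (?B v) * s"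
    proof (rule ccontr)
      assume "\<not> thesis"
      with that have gt: "card (?B v) * s < card (?S v) * b" if "v \<in> V" "?B v \<noteq> {}" for v
        using that by (meson not_le)
      obtain x where x: "x \<in> R" using False by blast
      have "(\<Sum>v\<in>V. card (?B v) * s) < (\<Sum>v\<in>V. card (?S v) * b)"
      proof (rule sum_strict_mono_ex1[OF fin])
        show "\<forall>v\<in>V. card (?B v) * s \<le> card (?S v) * b"
        proof
          fix v assume "v \<in> V"
          then show "card (?B v) * s \<le> card (?S v) * b"
            using gt[of v] by (cases "?B v = {}") (simp only: card.empty mult_0 le0,
                blast intro: less_imp_le)
        qed
        \<comment> \<open>A point of \<open>R\<close> lies in its own ball, so at least one of the
          inequalities summed is strict; centres with an empty share contribute 0 to the left
          side.\<close>
        have "x \<in> ?B x" using x less.prems refl by auto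
        then show "\<exists>v\<in>V. card (?B v) * s < card (?S v) * b"
          using gt[of x] x less.prems by blast
      qed
      moreover have "(\<Sum>v\<in>V. card (?B v) * s) = card R * b * s"
        using sum_card_swap[OF finR fin, of "\<lambda>x v. d x v \<le> r"] ball less.prems
        by (simp add: subset_iff flip: sum_distrib_right)
      moreover have "(\<Sum>v\<in>V. card (?S v) * b) = card R * s * b"
        using sum_card_swap[OF finR fin, of "\<lambda>x v. d x v = r"] sphere less.prems
        by (simp add: subset_iff flip: sum_distrib_right)
      ultimately show False by simp
    qed
    let ?R' = "R - ?B v"
    have card_R: "card R = card ?R' + card (?B v)"
      using finR card_mono[of R "?B v"] by (subst card_Diff_subset) auto
    have "card ?R' < card R"
      using v(2) finR by (intro psubset_card_mono) auto
    moreover have "?R' \<subseteq> V" using less.prems by blast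
    ultimately have "\<exists>S c. S \<subseteq> ?R' \<and> card S * b \<le> card ?R' * s \<and>
        (\<forall>x\<in>?R' - S. c x \<in> V \<and> d x (c x) \<le> r) \<and>
        (\<forall>x\<in>?R' - S. \<forall>y\<in>?R' - S. adj x y \<longrightarrow> c x = c y)"
      by (rule less.hyps)
    then obtain S c where S: "S \<subseteq> ?R'" "card S * b \<le> card ?R' * s"
      and c: "\<forall>x\<in>?R' - S. c x \<in> V \<and> d x (c x) \<le> r"
      and const: "\<forall>x\<in>?R' - S. \<forall>y\<in>?R' - S. adj x y \<longrightarrow> c x = c y"
      by (elim exE conjE)
    let ?c = "\<lambda>x. if d x v \<le> r then v else c x" and ?T = "S \<union> ?S v"
    have "card ?T * b \<le> (card S + card (?S v)) * b"
      by (intro mult_right_mono card_Un_le) auto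
    also have "\<dots> \<le> card R * s"
      using S(2) v(3) card_R by (simp add: algebra_simps)
    finally have card_T: "card ?T * b \<le> card R * s" .
    show ?thesis
    proof (intro exI[of _ ?T] exI[of _ ?c] conjI ballI impI)
      show "?T \<subseteq> R" using S by auto
      show "card ?T * b \<le> card R * s" by fact
      fix x assume x: "x \<in> R - ?T"
      show "?c x \<in> V" "d x (?c x) \<le> r" using x c v(1) by auto
      fix y assume y: "y \<in> R - ?T" and xy: "adj x y"
      have "x \<in> V" "y \<in> V" using x y less.prems by auto
      then have "d x v \<le> d y v + 1 \<and> d y v \<le> d x v + 1"
        using v(1) xy by (rule lip)
      moreover have "d x v \<noteq> r" "d y v \<noteq> r" using x y by auto
      \<comment> \<open>The distances to \<open>v\<close> differ by at most 1 and neither equals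
        \<open>r\<close>, so an edge cannot jump across the deleted sphere.\<close>
      ultimately have "d x v \<le> r \<longleftrightarrow> d y v \<le> r" by linarith
      then show "?c x = ?c y" using const x y xy by auto
    qed
  qed
qed

section \<open>Hamming balls and spheres in the cube\<close>

definition hamming :: "nat \<Rightarrow> (nat \<Rightarrow> nat) \<Rightarrow> (nat \<Rightarrow> nat) \<Rightarrow> nat" where
  "hamming n x y = card {i. i < n \<and> x i \<noteq> y i}"

lemma hamming_adjacent_le:
  assumes "\<exists>!i. i < n \<and> x i \<noteq> y i"
  shows "hamming n x v \<le> hamming n y v + 1"
proof -
  from assms obtain i where i: "\<And>j. j < n \<Longrightarrow> x j \<noteq> y j \<Longrightarrow> j = i" by blast
  have "hamming n x v \<le> card (insert i {i. i < n \<and> y i \<noteq> v i})"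
    unfolding hamming_def using i by (intro card_mono) auto
  also have "\<dots> \<le> hamming n y v + 1"
    unfolding hamming_def by (simp add: card_insert_if)
  finally show ?thesis .
qed

lemma card_hamming_sphere:
  assumes x: "x \<in> {..<n} \<rightarrow>\<^sub>E {0, 1}"
  shows "card {v \<in> {..<n} \<rightarrow>\<^sub>E {0, 1}. hamming n x v = r} = n choose r"
proof -
  let ?A = "{v \<in> {..<n} \<rightarrow>\<^sub>E {0, 1::nat}. hamming n x v = r}"
  let ?B = "{K. K \<subseteq> {..<n} \<and> card K = r}"
  let ?f = "\<lambda>v. {i. i < n \<and> x i \<noteq> v i}"
  \<comment> \<open>A vertex at distance \<open>r\<close> from \<open>x\<close> corresponds to the
    set of coordinates where it differs: \<open>?g K\<close> flips \<open>x\<close> on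
    \<open>K\<close>, and \<open>undefined\<close> outside the index range keeps it
    extensional.\<close>
  let ?g = "\<lambda>K i. if i < n then if i \<in> K then 1 - x i else x i else undefined"
  have x01: "x i = 0 \<or> x i = 1" if "i < n" for i
    using x that by (auto simp: PiE_iff)
  have fg: "?f (?g K) = K" if "K \<subseteq> {..<n}" for K
    using that x01 by (fastforce split: if_splits)
  have "bij_betw ?f ?A ?B"
  proof (rule bij_betw_byWitness[where f' = ?g])
    show "\<forall>v\<in>?A. ?g (?f v) = v"
    proof (intro ballI ext)
      fix v i assume "v \<in> ?A"
      then have "i < n \<Longrightarrow> v i = 0 \<or> v i = 1" "\<not> i < n \<Longrightarrow> v i = undefined"
        by (auto simp: PiE_iff extensional_def)
      then show "?g (?f v) i = v i"
        using x01[of i] by (cases "i < n") auto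
    qed
    show "\<forall>K\<in>?B. ?f (?g K) = K" using fg by blast
    show "?f ` ?A \<subseteq> ?B" by (auto simp: hamming_def)
    show "?g ` ?B \<subseteq> ?A"
    proof
      fix v assume "v \<in> ?g ` ?B"
      then obtain K where K: "K \<subseteq> {..<n}" "card K = r" "v = ?g K" by blast
      have "?g K \<in> {..<n} \<rightarrow>\<^sub>E {0, 1}" using x01 by (auto simp: PiE_iff extensional_def)
      moreover have "hamming n x (?g K) = r"
        unfolding hamming_def using fg[OF K(1)] K(2) by simp
      ultimately show "v \<in> ?A" using K(3) by simp
    qed
  qed
  then have "card ?A = card ?B" by (rule bij_betw_same_card)
  then show ?thesis using n_subsets[of "{..<n}" r] by simp
qed

lemma card_hamming_ball:
  assumes x: "x \<in> {..<n} \<rightarrow>\<^sub>E {0, 1}"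
  shows "card {v \<in> {..<n} \<rightarrow>\<^sub>E {0, 1}. hamming n x v \<le> r} = (\<Sum>j\<le>r. n choose j)"
proof -
  have "{v \<in> {..<n} \<rightarrow>\<^sub>E {0, 1}. hamming n x v \<le> r}
      = (\<Union>j\<le>r. {v \<in> {..<n} \<rightarrow>\<^sub>E {0, 1}. hamming n x v = j})"
    by auto
  also have "card \<dots> = (\<Sum>j\<le>r. card {v \<in> {..<n} \<rightarrow>\<^sub>E {0, 1}. hamming n x v = j})"
    by (rule card_UN_disjoint) (auto simp: finite_PiE)
  finally show ?thesis using card_hamming_sphere[OF x] by simp
qed

text \<open>Carving is applied to the whole cube, with \<open>t\<close> the number of deleted
  vertices. The radius \<open>r\<close> stays free, to be optimised later.\<close>

lemma integrity_hypercube_le: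
  obtains t where "integrity (with_proj (hypercube n)) \<le> t + (\<Sum>j\<le>r. n choose j)"
    and "t * (\<Sum>j\<le>r. n choose j) \<le> 2 ^ n * (n choose r)"
proof -
  let ?V = "{..<n} \<rightarrow>\<^sub>E {0, 1::nat}"
  let ?adj = "\<lambda>x y :: nat \<Rightarrow> nat. \<exists>!i. i < n \<and> x i \<noteq> y i"
  have fin: "finite ?V" by (simp add: finite_PiE)
  have sym: "?adj y x" if "?adj x y" for x y
    using that by (simp only: eq_commute[of "y _"])
  have ball: "card {v \<in> ?V. hamming n x v \<le> r} = (\<Sum>j\<le>r. n choose j)" if "x \<in> ?V" for x
    using card_hamming_ball[OF that] .
  have comm: "hamming n x v = hamming n v x" for x v
    unfolding hamming_def by (simp only: eq_commute[of "x _"])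
  have lip: "hamming n x v \<le> hamming n y v + 1 \<and> hamming n y v \<le> hamming n x v + 1"
    if "?adj x y" for x y v
    using hamming_adjacent_le[OF that] hamming_adjacent_le[OF sym[OF that]] by (rule conjI)
  have verts: "verts (with_proj (hypercube n)) = ?V" by (simp add: hypercube_def)
  have refl: "hamming n x x = 0" for x by (simp add: hamming_def)
  have "\<exists>S c. S \<subseteq> ?V \<and> card S * (\<Sum>j\<le>r. n choose j) \<le> card ?V * (n choose r) \<and>
    (\<forall>x\<in>?V - S. c x \<in> ?V \<and> hamming n x (c x) \<le> r) \<and>
    (\<forall>x\<in>?V - S. \<forall>y\<in>?V - S. ?adj x y \<longrightarrow> c x = c y)"
    by (rule ball_decomposition[where d = "hamming n" and adj = ?adj and r = r, OF fin refl lip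
      card_hamming_sphere ball order_refl])
  then obtain S c where S: "S \<subseteq> ?V" "card S * (\<Sum>j\<le>r. n choose j) \<le> card ?V * (n choose r)"
    and c: "\<forall>x\<in>?V - S. c x \<in> ?V \<and> hamming n x (c x) \<le> r"
    and const: "\<forall>x\<in>?V - S. \<forall>y\<in>?V - S. ?adj x y \<longrightarrow> c x = c y"
    by (elim exE conjE)
  have "integrity (with_proj (hypercube n)) \<le> card S + (\<Sum>j\<le>r. n choose j)"
  proof (rule integrity_le[where c = c])
    fix x assume "x \<in> verts (with_proj (hypercube n)) - S"
    then have x: "x \<in> ?V - S" unfolding verts .
    \<comment> \<open>All survivors with the label of \<open>x\<close> lie within \<open>r\<close>
      of the common centre \<open>c x\<close>.\<close>
    have "{y \<in> ?V - S. c y = c x} \<subseteq> {v \<in> ?V. hamming n (c x) v \<le> r}"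
    proof
      fix y assume y: "y \<in> {y \<in> ?V - S. c y = c x}"
      then have "hamming n y (c y) \<le> r" using bspec[OF c, of y] by simp
      with y show "y \<in> {v \<in> ?V. hamming n (c x) v \<le> r}" using comm[of y "c x"] by simp
    qed
    then have "card {y \<in> ?V - S. c y = c x} \<le> card {v \<in> ?V. hamming n (c x) v \<le> r}"
      by (rule card_mono[rotated]) (rule finite_subset[OF _ fin], blast)
    also have "\<dots> = (\<Sum>j\<le>r. n choose j)" using ball bspec[OF c x] by blast
    finally show "card {y \<in> verts (with_proj (hypercube n)) - S. c y = c x} \<le> (\<Sum>j\<le>r. n choose j)"
      unfolding verts .
  next
    fix e
    assume e: "e \<in> arcs (with_proj (hypercube n))"
      and t: "tail (with_proj (hypercube n)) e \<in> verts (with_proj (hypercube n)) - S"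
      and h: "head (with_proj (hypercube n)) e \<in> verts (with_proj (hypercube n)) - S"
    have "?adj (fst e) (snd e)"
      using e unfolding hypercube_def by (simp only: with_proj_simps pair_pre_digraph.simps
          mem_Collect_eq split_beta)
    then show "c (tail (with_proj (hypercube n)) e) = c (head (with_proj (hypercube n)) e)"
      using const t h unfolding verts by (simp only: with_proj_simps)
  next
    show "finite (verts (with_proj (hypercube n)))" using fin unfolding verts .
    show "S \<subseteq> verts (with_proj (hypercube n))" using S(1) unfolding verts .
  qed
  moreover have "card ?V = 2 ^ n" by (simp add: card_PiE numeral_2_eq_2)
  ultimately show ?thesis using that[of "card S"] S(2) by simp
qed

text \<open>Deleting every vertex gives this; it covers the small \<open>n\<close> for which the
  main estimate does not apply.\<close>

lemma integrity_hypercube_le_card: "integrity (with_proj (hypercube n)) \<le> 2 ^ n"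
proof -
  have "integrity (with_proj (hypercube n)) \<le> card (verts (with_proj (hypercube n))) + 0"
    by (rule integrity_le) (auto simp: hypercube_def finite_PiE)
  then show ?thesis by (simp add: hypercube_def card_PiE numeral_2_eq_2)
qed

section \<open>Binomial estimates and the choice of the radius\<close>

text \<open>Divided by \<open>2 ^ n\<close>, the sum is the lower tail of a fair binomial
  distribution, to which Hoeffding's inequality applies.\<close>

lemma sum_binomial_le_exp:
  assumes "real r \<le> real n / 2 - a" "a \<ge> 0" "n > 0"
  shows "real (\<Sum>j\<le>r. n choose j) \<le> 2 ^ n * exp (- 2 * a\<^sup>2 / real n)"
proof -
  interpret binomial_distribution n "1 / 2 :: real" by unfold_locales auto
  have "real (n choose j) / 2 ^ n = pmf (binomial_pmf n (1 / 2)) j" for j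
  proof (cases "j \<le> n")
    case True
    then have "(1 / 2) ^ j * (1 / 2) ^ (n - j) = (1 / 2 :: real) ^ n"
      by (metis le_add_diff_inverse power_add)
    then show ?thesis by (simp add: pmf_binomial mult.assoc power_one_over)
  qed (simp add: pmf_binomial binomial_eq_0)
  then have "real (\<Sum>j\<le>r. n choose j) / 2 ^ n = measure_pmf.prob (binomial_pmf n (1 / 2)) {..r}"
    by (simp add: measure_measure_pmf_finite sum_divide_distrib)
  also have "\<dots> \<le> measure_pmf.prob (binomial_pmf n (1 / 2)) {x. x \<le> real n * (1 / 2) - a}"
    using assms(1) by (intro measure_pmf.finite_measure_mono) auto
  also have "\<dots> \<le> exp (- 2 * a\<^sup>2 / real n)"
    using assms(2,3) by (intro prob_le) auto
  finally show ?thesis by (simp add: field_simps)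
qed

text \<open>The quotient of \<open>n choose m\<close> by \<open>n choose Suc m\<close> is
  \<open>Suc m / (n - m)\<close>, which increases with \<open>m\<close>. Hypothesis
  \<open>ratio\<close> bounds it below by \<open>1 - \<delta>\<close> at the worst index
  \<open>m = r - k\<close>, and \<open>i\<close> such steps multiply up.\<close>

lemma binomial_diff_ge:
  fixes \<delta> :: real
  assumes "k \<le> r" "r \<le> n" "0 \<le> \<delta>" "\<delta> \<le> 1"
    and ratio: "(1 - \<delta>) * (real n - real r + real k) \<le> real r - real k + 1"
    and "i \<le> k"
  shows "(1 - \<delta>) ^ i * real (n choose r) \<le> real (n choose (r - i))"
  using \<open>i \<le> k\<close>
proof (induction i)
  case 0
  then show ?case by simp
next
  case (Suc i)
  define m where "m = r - Suc i"
  have m: "r - i = Suc m" "Suc m \<le> n" "real m \<ge> real r - real k"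
    using Suc.prems assms(1,2) unfolding m_def by auto
  \<comment> \<open>Both sides equal \<open>n * (n - 1 choose m)\<close>.\<close>
  have "Suc m * (n choose Suc m) = (n - m) * (n choose m)"
    using times_binomial_minus1_eq[of "Suc m" n] binomial_absorb_comp[of n m] by simp
  then have eq: "real (Suc m) * real (n choose Suc m) = (real n - real m) * real (n choose m)"
    using m(2) by (metis Suc_leD of_nat_diff of_nat_mult)
  have "(1 - \<delta>) * (real n - real m) \<le> (1 - \<delta>) * (real n - real r + real k)"
    using assms(4) m(3) by (intro mult_left_mono) auto
  also have "\<dots> \<le> real (Suc m)" using ratio m(3) by simp
  finally have "(1 - \<delta>) * (real n - real m) * real (n choose Suc m)
      \<le> real (Suc m) * real (n choose Suc m)"
    by (rule mult_right_mono) simp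
  then have "(real n - real m) * ((1 - \<delta>) * real (n choose Suc m))
      \<le> (real n - real m) * real (n choose m)"
    using eq by (simp add: mult_ac)
  then have step: "(1 - \<delta>) * real (n choose Suc m) \<le> real (n choose m)"
    using m(2) by (simp add: mult_le_cancel_left)
  have "(1 - \<delta>) ^ Suc i * real (n choose r) \<le> (1 - \<delta>) * real (n choose Suc m)"
    using Suc.IH Suc.prems assms(4) m(1) by (simp add: mult_left_mono mult.assoc)
  with step show ?case unfolding m_def by simp
qed

lemma exists_radius:
  fixes n :: nat and e :: real
  assumes n: "n \<ge> 3" and e_def: "e = sqrt (ln (real n) / real n)" and e: "e \<le> 1 / 100"
  obtains r where "real (\<Sum>j\<le>r. n choose j) \<le> e * 2 ^ n"
    and "real (n choose r) \<le> 40 * e * real (\<Sum>j\<le>r. n choose j)"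
proof -
  \<comment> \<open>Here \<open>n \<ge> 3\<close> enters, through
    \<open>exp 1 \<le> 3\<close>.\<close>
  have ln1: "ln (real n) \<ge> 1"
    using n exp_le by (subst ln_ge_iff) auto
  then have e0: "e > 0" using n unfolding e_def by simp
  have e2: "real n * e\<^sup>2 = ln (real n)"
    using n ln1 unfolding e_def by simp
  have "1 \<le> (real n * e) * e" using e2 ln1 by (simp add: power2_eq_square mult.assoc)
  then have inv_e: "1 / e \<le> real n * e" using e0 by (simp add: field_simps)
  moreover have "1 / e \<ge> 1" using e e0 by (simp add: field_simps)
  ultimately have ne: "real n * e \<ge> 1" by linarith
  have ne_le: "real n * e \<le> real n / 100"
    using mult_left_mono[OF e, of "real n"] by simp
  \<comment> \<open>The offset \<open>n * e / 2\<close> below the middle turns Hoeffding's exponent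
    into \<open>- ln n / 2\<close>. The depth \<open>k\<close> is chosen so that
    \<open>k * (10 * e) \<le> 1 / 2\<close>, whence Bernoulli's inequality keeps
    \<open>(1 - 10 * e) ^ k\<close> at least \<open>1 / 2\<close>.\<close>
  define r where "r = nat \<lfloor>real n / 2 - real n * e / 2\<rfloor>"
  define k where "k = nat \<lfloor>1 / (20 * e)\<rfloor>"
  have r: "real r \<le> real n / 2 - real n * e / 2" "real r \<ge> real n / 2 - real n * e / 2 - 1"
    using ne_le unfolding r_def by linarith+
  have k: "real k \<le> 1 / (20 * e)" "real k + 1 \<ge> 1 / (20 * e)"
    using zero_le_divide_1_iff[of "20 * e"] e0 unfolding k_def by linarith+
  have k_le: "real k \<le> real n * e / 20"
    using k(1) inv_e by (simp add: field_simps)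
  have "real (\<Sum>j\<le>r. n choose j) \<le> 2 ^ n * exp (- 2 * (real n * e / 2)\<^sup>2 / real n)"
    using r(1) e0 n by (intro sum_binomial_le_exp) auto
  also have "- 2 * (real n * e / 2)\<^sup>2 / real n = - (ln (real n) / 2)"
    using e2 n by (simp add: power2_eq_square field_simps)
  also have "exp (- (ln (real n) / 2)) = 1 / sqrt (real n)"
    using n by (simp add: exp_minus ln_sqrt[symmetric] field_simps)
  also have "2 ^ n * (1 / sqrt (real n)) \<le> e * 2 ^ n"
    using ln1 unfolding e_def by (simp add: real_sqrt_divide divide_right_mono)
  finally have ball: "real (\<Sum>j\<le>r. n choose j) \<le> e * 2 ^ n" .
  have kr: "k \<le> r" "r \<le> n" using r k_le ne ne_le by linarith+
  have half: "1 / 2 * real (n choose r) \<le> real (n choose (r - i))" if "i \<le> k" for i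
  proof -
    have "real i * (10 * e) \<le> 1 / (20 * e) * (10 * e)"
      using that k(1) e0 by (intro mult_right_mono) auto
    then have "1 / 2 \<le> 1 + real i * (- (10 * e))" using e0 by simp
    also have "\<dots> \<le> (1 + - (10 * e)) ^ i" using e by (intro Bernoulli_inequality) simp
    finally have "1 / 2 * real (n choose r) \<le> (1 - 10 * e) ^ i * real (n choose r)"
      by (intro mult_right_mono) auto
    also have "\<dots> \<le> real (n choose (r - i))"
    proof (rule binomial_diff_ge[OF kr _ _ _ that])
      \<comment> \<open>Rounding and \<open>k\<close> cost only multiples of \<open>n * e\<close>,
        since \<open>1 \<le> n * e\<close>. The factor \<open>1 - 10 * e\<close> takes
        \<open>5 * n * e\<close> off \<open>n / 2\<close>, enough to pass from
        \<open>5 / 2 * n * e\<close> above the middle to as much below it.\<close>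
      have "(1 - 10 * e) * (real n - real r + real k) \<le> (1 - 10 * e) * (real n / 2 + 5 / 2 * (real n * e))"
        using r k_le ne e by (intro mult_left_mono) linarith+
      also have "\<dots> = real n / 2 - 5 / 2 * (real n * e) - 25 * e * (real n * e)"
        by (simp add: field_simps)
      also have "\<dots> \<le> real n / 2 - 5 / 2 * (real n * e)" using e0 by simp
      also have "\<dots> \<le> real r - real k + 1" using r k_le ne by linarith
      finally show "(1 - 10 * e) * (real n - real r + real k) \<le> real r - real k + 1" .
    qed (use e e0 in auto)
    finally show ?thesis .
  qed
  \<comment> \<open>The outermost \<open>k + 1\<close> spheres of the ball each have at least half
    the size of the last one; the constant 40 is \<open>20 * 2\<close>.\<close>
  have "1 / (20 * e) * (1 / 2 * real (n choose r)) \<le> (real k + 1) * (1 / 2 * real (n choose r))"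
    using k(2) by (intro mult_right_mono) auto
  also have "\<dots> = (\<Sum>i\<le>k. 1 / 2 * real (n choose r))" by simp
  also have "\<dots> \<le> (\<Sum>i\<le>k. real (n choose (r - i)))"
    using half by (intro sum_mono) auto
  \<comment> \<open>By \<open>k \<le> r\<close> the natural subtraction is not truncated, so the
    reindexing is injective.\<close>
  also have "\<dots> = (\<Sum>j\<in>(\<lambda>i. r - i) ` {..k}. real (n choose j))"
    using kr(1) by (subst sum.reindex) (auto simp: inj_on_def)
  also have "\<dots> \<le> (\<Sum>j\<le>r. real (n choose j))"
    by (intro sum_mono2) auto
  finally have "real (n choose r) \<le> 40 * e * real (\<Sum>j\<le>r. n choose j)"
    using e0 by (simp add: field_simps)
  with ball that show thesis by blast
qed

text \<open>For \<open>n = 0\<close> and \<open>n = 1\<close> the right-hand side is 0 (by division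
  by zero and by \<open>ln 1 = 0\<close>) while the integrity is positive, so the claim starts at
  \<open>n = 2\<close>.\<close>

theorem theorem1p4:
  shows "\<exists>C::real. C > 0 \<and>
    (\<forall>n::nat. n \<ge> 2 \<longrightarrow>
      real (integrity (with_proj (hypercube n))) \<le> C * (2 ^ n / sqrt (real n)) * sqrt (ln (real n)))"
\<comment> \<open>With 100, the trivial bound \<open>2 ^ n\<close> suffices when
  \<open>e > 1 / 100\<close>; otherwise deletions and one ball cost \<open>40 * e * 2 ^ n\<close>
  and \<open>e * 2 ^ n\<close>.\<close>
proof (intro exI[of _ 100] conjI allI impI)
  fix n :: nat assume n: "n \<ge> 2"
  define e where "e = sqrt (ln (real n) / real n)"
  have eq: "100 * (2 ^ n / sqrt (real n)) * sqrt (ln (real n)) = 100 * e * 2 ^ n"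
    unfolding e_def by (simp add: real_sqrt_divide)
  have "real (integrity (with_proj (hypercube n))) \<le> 100 * e * 2 ^ n"
  proof (cases "e \<le> 1 / 100")
    case False
    have "real (integrity (with_proj (hypercube n))) \<le> 2 ^ n"
      using integrity_hypercube_le_card[of n] by (metis of_nat_le_iff of_nat_numeral of_nat_power)
    also have "\<dots> \<le> 100 * e * 2 ^ n" using False by simp
    finally show ?thesis .
  next
    case True
    \<comment> \<open>For \<open>n = 2\<close> already \<open>e \<ge> 1 / 2\<close>, because
      \<open>ln 2 / 2 \<ge> 1 / 4\<close>.\<close>
    have "n \<noteq> 2"
    proof
      assume "n = 2"
      then have "sqrt (1 / 4) \<le> e"
        unfolding e_def using ln2_ge_two_thirds by (intro real_sqrt_le_mono) simp
      with True show False by (simp add: real_sqrt_divide)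
    qed
    with n have "n \<ge> 3" by simp
    then obtain r where r: "real (\<Sum>j\<le>r. n choose j) \<le> e * 2 ^ n"
      "real (n choose r) \<le> 40 * e * real (\<Sum>j\<le>r. n choose j)"
      using exists_radius e_def True by blast
    define b where "b = (\<Sum>j\<le>r. n choose j)"
    obtain t where t: "integrity (with_proj (hypercube n)) \<le> t + b" "t * b \<le> 2 ^ n * (n choose r)"
      using integrity_hypercube_le unfolding b_def by blast
    have "b > 0" unfolding b_def by (rule sum_pos2[of _ 0]) auto
    have "real t * real b \<le> 2 ^ n * real (n choose r)"
      using of_nat_mono[OF t(2), where 'a = real] by simp
    also have "\<dots> \<le> 2 ^ n * (40 * e * real b)"
      using r(2) unfolding b_def by (intro mult_left_mono) auto
    finally have "real t * real b \<le> (40 * e * 2 ^ n) * real b" by (simp add: mult_ac)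
    then have "real t \<le> 40 * e * 2 ^ n"
      using \<open>b > 0\<close> by (simp only: mult_le_cancel_right_pos of_nat_0_less_iff)
    moreover have "real (integrity (with_proj (hypercube n))) \<le> real t + real b"
      using t(1) by linarith
    moreover have "real b \<le> e * 2 ^ n" using r(1) unfolding b_def .
    moreover have "e * 2 ^ n \<ge> 0" unfolding e_def using n by simp
    ultimately show ?thesis by linarith
  qed
  then show "real (integrity (with_proj (hypercube n)))
      \<le> 100 * (2 ^ n / sqrt (real n)) * sqrt (ln (real n))"
    unfolding eq .
qed simp

end
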